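(* Let $f:\mathbb{R}^2\to\mathbb{R}^2$ be an orientation preserving homeomorphism which satisfies the topological shadowing property. Then $f$ has a fixed point.
   Context: Let $(X,d)$ be a metric space and $f:X\to X$ a homeomorphism. Let $\mathcal{C}^+=\{\epsilon:X\to\mathbb{R}^+ : \epsilon \text{ continuous}\}$ (strictly positive continuous functions). For $\delta\in\mathcal{C}^+$, a sequence $\{x_n\}_{n\in\mathbb{Z}}\subset X$ is a $\delta$-pseudo-orbit of $f$ if $d(f(x_n),x_{n+1})<\delta(f(x_n))$ for every $n\in\mathbb{Z}$. For $\epsilon\in\mathcal{C}^+$, the sequence $\{x_n\}$ is $\epsilon$-shadowed by an orbit if there is $y\in X$ with $d(f^n(y),x_n)<\epsilon(x_n)$ for every $n\in\mathbb{Z}$. The homeomorphism $f$ satisfies the topological shadowing property if for every $\epsilon\in\mathcal{C}^+$ there exists $\delta\in\mathcal{C}^+$ such that every $\delta$-pseudo-orbit is $\epsilon$-shadowed by an orbit. On $\mathbb{R}^d$ the metric is the Euclidean one. *)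

theory Defs
  imports "HOL-Analysis.Analysis"
begin

definition pos_cont_fun :: "('a::metric_space \<Rightarrow> real) \<Rightarrow> bool" where
  "pos_cont_fun e \<longleftrightarrow> continuous_on UNIV e \<and> (\<forall>x. e x > 0)"

definition int_iter :: "('a \<Rightarrow> 'a) \<Rightarrow> int \<Rightarrow> 'a \<Rightarrow> 'a" where
  "int_iter f n = (if n \<ge> 0 then f ^^ nat n else inv f ^^ nat (- n))"

definition pseudo_orbit :: "('a::metric_space \<Rightarrow> 'a) \<Rightarrow> ('a \<Rightarrow> real) \<Rightarrow> (int \<Rightarrow> 'a) \<Rightarrow> bool" where
  "pseudo_orbit f \<delta> xs \<longleftrightarrow> (\<forall>n. dist (f (xs n)) (xs (n + 1)) < \<delta> (f (xs n)))"

definition shadowed :: "('a::metric_space \<Rightarrow> 'a) \<Rightarrow> ('a \<Rightarrow> real) \<Rightarrow> (int \<Rightarrow> 'a) \<Rightarrow> bool" where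
  "shadowed f \<epsilon> xs \<longleftrightarrow> (\<exists>y. \<forall>n. dist (int_iter f n y) (xs n) < \<epsilon> (xs n))"

definition topological_shadowing :: "('a::metric_space \<Rightarrow> 'a) \<Rightarrow> bool" where
  "topological_shadowing f \<longleftrightarrow>
     (\<forall>\<epsilon>. pos_cont_fun \<epsilon> \<longrightarrow>
        (\<exists>\<delta>. pos_cont_fun \<delta> \<and> (\<forall>xs. pseudo_orbit f \<delta> xs \<longrightarrow> shadowed f \<epsilon> xs)))"

text \<open>Orientation preserving (for a homeomorphism of the plane): the local degree is +1
  at every point, i.e. for every point p and radius r > 0 the induced circle map
  z \<mapsto> (f(p + r z) - f p)/|f(p + r z) - f p| on the unit circle is homotopic
  (as a map of the unit circle into itself) to the identity, i.e. has degree 1.\<close>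
definition orientation_preserving :: "(real^2 \<Rightarrow> real^2) \<Rightarrow> bool" where
  "orientation_preserving f \<longleftrightarrow>
     (\<forall>p r. r > 0 \<longrightarrow>
        homotopic_with_canon (\<lambda>_. True) (sphere 0 1) (sphere 0 1)
          (\<lambda>z. (1 / norm (f (p + r *\<^sub>R z) - f p)) *\<^sub>R (f (p + r *\<^sub>R z) - f p)) id)"

end

theory Submission
  imports Defs
begin

text \<open>Suppose that \<open>f\<close> has no fixed point. Following Brouwer, every point then has a neighbourhood
  which is disjoint from all its iterates: a recurrent free set could be closed up, by perturbing
  \<open>f\<close> inside free sets (which creates no fixed point), to a periodic orbit; its period can be
  shortened step by step to 2, and an orientation preserving homeomorphism of the plane which
  exchanges two points has a fixed point. So orbits are locally finite, and a function \<open>\<epsilon>\<close> which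
  decays fast along one orbit forces each half of this orbit to be shadowed by itself only. A
  pseudo-orbit that jumps once from that orbit to a nearby one is therefore not shadowed.\<close>

section \<open>Shadowing and wandering points\<close>

text \<open>Perturbing inside a free set changes the map, so return times are bounded below for all
  fixed point free orientation preserving homeomorphisms at once, and orientation must be recorded
  in a form that survives composition. Logarithms of difference quotients do this, which is why the
  work takes place over \<open>complex\<close>. The arc that shortens a period is thickened to a set
  that need not be a ball, so the induction speaks of connected open free sets. Shortening stops at
  period 2 because the geometry of that arc already relies on the absence of returns after two
  steps. Wandering is needed at every point of the plane and not only along the chosen orbit, since
  \<epsilon> has to stay positive wherever the orbit might accumulate.\<close>

lemma int_iter_nat_add:
  assumes "bij f"
  shows "int_iter f (n + int k) x = (f ^^ k) (int_iter f n x)"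
proof (induction k)
  case (Suc k)
  have step: "int_iter f (m + 1) x = f (int_iter f m x)" for m
  proof (cases "m \<ge> 0")
    case True
    then have "nat (m + 1) = Suc (nat m)" by simp
    with True show ?thesis by (simp add: int_iter_def)
  next
    case False
    then have l: "nat (- m) = Suc (nat (- (m + 1)))" by linarith
    have "f (inv f y) = y" for y using assms by (simp add: bij_is_surj surj_f_inv_f)
    with False l show ?thesis
      by (cases "m = -1") (auto simp: int_iter_def)
  qed
  show ?case using step[of "n + int k"] Suc by (simp add: algebra_simps)
qed simp

lemma int_iter_cancel:
  assumes "bij f"
  shows "int_iter f (- n) (int_iter f n x) = x"
proof -
  have inj: "inj f" and surj: "surj f" using assms by (auto simp: bij_def)
  have 1: "(inv f ^^ k) ((f ^^ k) y) = y" for k y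
    using inj by (induction k arbitrary: y) (simp_all add: funpow_swap1)
  have 2: "(f ^^ k) ((inv f ^^ k) y) = y" for k y
    using surj by (induction k arbitrary: y) (simp_all add: funpow_swap1 surj_f_inv_f)
  show ?thesis
    using 1[of "nat n"] 2[of "nat (- n)"] by (auto simp: int_iter_def)
qed

lemma continuous_on_int_iter:
  assumes "homeomorphism UNIV UNIV f g"
  shows "continuous_on UNIV (int_iter f n)"
proof -
  have "inv f = g" using assms
    by (metis UNIV_I homeomorphism_def inv_equality)
  moreover have "continuous_on UNIV f" "continuous_on UNIV g"
    using assms by (auto simp: homeomorphism_def)
  moreover have "continuous_on UNIV (h ^^ k)" if "continuous_on UNIV h" for h :: "'a \<Rightarrow> 'a" and k
    by (induction k) (auto intro: that continuous_on_compose2[OF that] simp: o_def id_def)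
  ultimately show ?thesis by (simp add: int_iter_def)
qed

text \<open>If an orbit meets small balls at most once, \<open>\<epsilon>\<close> can be prescribed along it so
  that only the orbit itself shadows its two halves; a pseudo-orbit with a single jump
  is then not shadowed.\<close>

lemma wandering_imp_not_topological_shadowing:
  fixes f :: "'a::{metric_space,perfect_space} \<Rightarrow> 'a"
  assumes homeo: "homeomorphism UNIV UNIV f g"
    and wandering: "\<And>y. \<exists>U. open U \<and> y \<in> U \<and> (\<forall>n\<ge>1. \<forall>u\<in>U. (f ^^ n) u \<notin> U)"
  shows "\<not> topological_shadowing f"
proof
  assume shadowing: "topological_shadowing f"
  have bij: "bij f"
    using homeo by (metis UNIV_I bij_betw_def homeomorphism_def inj_on_inverseI)
  obtain x :: 'a where True by simp
  define orb where "orb n = int_iter f n x" for n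
  have cancel: "int_iter f (- n) (int_iter f n y) = y" for n y
    by (rule int_iter_cancel[OF bij])
  \<comment> \<open>Closeness at time \<open>n\<close> is measured after pulling back to time 0; the
    bound tends to 0 as \<open>n\<close> goes to either infinity.\<close>
  have "\<exists>e>0. \<forall>y. dist y (orb n) < e \<longrightarrow> dist (int_iter f (- n) y) x < 1 / (1 + \<bar>real_of_int n\<bar>)" for n
  proof -
    have "isCont (int_iter f (- n)) (orb n)"
      using continuous_on_int_iter[OF homeo] by (simp add: continuous_on_eq_continuous_at)
    moreover have "int_iter f (- n) (orb n) = x" by (simp add: orb_def cancel)
    ultimately show ?thesis
      by (auto simp: continuous_at_eps_delta dest!: spec[where x="1 / (1 + \<bar>real_of_int n\<bar>)"])
  qed
  then obtain \<eta> where \<eta>0: "\<And>n. \<eta> n > 0"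
    and \<eta>: "\<And>n y. dist y (orb n) < \<eta> n \<Longrightarrow> dist (int_iter f (- n) y) x < 1 / (1 + \<bar>real_of_int n\<bar>)"
    by metis
  \<comment> \<open>The factor 1/2 makes \<epsilon> Lipschitz with constant 1/2. In the shadowing
    condition \<epsilon> is evaluated at the pseudo-orbit, which for \<open>n \<ge> 0\<close> is not
    \<open>orb n\<close>; a distance \<open>t < \<epsilon> w \<le> (\<eta> n + t) / 2\<close> still
    gives \<open>t < \<eta> n\<close>.\<close>
  define \<epsilon> where "\<epsilon> y = (INF n. (\<eta> n + dist y (orb n)) / 2)" for y
  have bdd: "bdd_below (range (\<lambda>n. (\<eta> n + dist y (orb n)) / 2))" for y
    using \<eta>0 by (intro bdd_belowI[where m=0]) (auto intro!: add_nonneg_nonneg simp: less_imp_le)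
  have \<epsilon>_le: "\<epsilon> y \<le> (\<eta> n + dist y (orb n)) / 2" for n y
    unfolding \<epsilon>_def by (rule cINF_lower[OF bdd]) simp
  have lip: "\<epsilon> y \<le> \<epsilon> w + dist y w / 2" for y w
  proof -
    have "\<epsilon> y - dist y w / 2 \<le> \<epsilon> w"
      unfolding \<epsilon>_def[of w]
    proof (rule cINF_greatest)
      fix n
      have "\<epsilon> y \<le> (\<eta> n + dist y (orb n)) / 2" by (rule \<epsilon>_le)
      moreover have "dist y (orb n) \<le> dist y w + dist w (orb n)" by (rule dist_triangle)
      ultimately show "\<epsilon> y - dist y w / 2 \<le> (\<eta> n + dist w (orb n)) / 2" by (simp add: field_simps)
    qed simp
    then show ?thesis by simp
  qed
  \<comment> \<open>A wandering neighbourhood of \<open>y\<close> contains at most one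
    \<open>orb i\<close>. All other terms of the infimum are at least \<open>r / 2\<close>, and the
    exceptional one is at least \<open>\<eta> i / 2\<close>.\<close>
  have pos: "\<epsilon> y > 0" for y
  proof -
    obtain U where U: "open U" "y \<in> U" "\<And>n u. n \<ge> 1 \<Longrightarrow> u \<in> U \<Longrightarrow> (f ^^ n) u \<notin> U"
      using wandering by metis
    obtain r where r: "r > 0" "ball y r \<subseteq> U" using U openE by blast
    have once: "\<not> (i < j \<and> orb i \<in> U \<and> orb j \<in> U)" for i j
    proof clarify
      assume ij: "i < j" "orb i \<in> U" "orb j \<in> U"
      then have "orb j = (f ^^ nat (j - i)) (orb i)"
        using int_iter_nat_add[OF bij, of i "nat (j - i)" x] by (simp add: orb_def)
      then show False using U(3)[of "nat (j - i)" "orb i"] ij by simp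
    qed
    have "\<exists>c>0. \<forall>n. c \<le> (\<eta> n + dist y (orb n)) / 2"
    proof (cases "\<exists>i. orb i \<in> U")
      case True
      then obtain i where i: "orb i \<in> U" by blast
      have "min r (\<eta> i) / 2 \<le> (\<eta> n + dist y (orb n)) / 2" for n
      proof (cases "n = i")
        case False
        then have "orb n \<notin> U" using once[of n i] once[of i n] i by linarith
        then have "dist y (orb n) \<ge> r" using r(2) by (meson linorder_not_less mem_ball subsetD)
        then show ?thesis using \<eta>0[of n] by (simp add: min_def)
      qed (use \<eta>0[of i] in \<open>auto simp: min_def intro: add_increasing2\<close>)
      moreover have "min r (\<eta> i) / 2 > 0" using r \<eta>0 by simp
      ultimately show ?thesis by blast
    next
      case False
      then have "dist y (orb n) \<ge> r" for n using r(2) by (meson linorder_not_less mem_ball subsetD)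
      then have "r / 2 \<le> (\<eta> n + dist y (orb n)) / 2" for n using \<eta>0[of n] by (smt (verit) divide_right_mono)
      then show ?thesis using r(1) half_gt_zero by blast
    qed
    then obtain c where "c > 0" "\<And>n. c \<le> (\<eta> n + dist y (orb n)) / 2" by blast
    then have "c \<le> \<epsilon> y" unfolding \<epsilon>_def by (intro cINF_greatest) auto
    with \<open>c > 0\<close> show ?thesis by simp
  qed
  have "continuous_on UNIV \<epsilon>"
  proof (rule continuous_on_iff[THEN iffD2], intro ballI allI impI)
    fix y and e :: real assume "e > 0"
    show "\<exists>d>0. \<forall>w\<in>UNIV. dist w y < d \<longrightarrow> dist (\<epsilon> w) (\<epsilon> y) < e"
    proof (intro exI conjI ballI impI)
      fix w assume "dist w y < e"
      then show "dist (\<epsilon> w) (\<epsilon> y) < e"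
        using lip[of w y] lip[of y w] zero_le_dist[of w y] unfolding dist_real_def dist_commute[of y w] by linarith
    qed fact
  qed
  then have "pos_cont_fun \<epsilon>" using pos by (simp add: pos_cont_fun_def)
  then obtain \<delta> where \<delta>: "pos_cont_fun \<delta>" "\<And>xs. pseudo_orbit f \<delta> xs \<Longrightarrow> shadowed f \<epsilon> xs"
    using shadowing unfolding topological_shadowing_def by blast
  have \<delta>0: "\<delta> y > 0" for y using \<delta>(1) by (simp add: pos_cont_fun_def)
  obtain x' where x': "x' \<noteq> x" "dist x' x < \<delta> x"
    using perfect_choose_dist[OF \<delta>0] by blast
  \<comment> \<open>The only jump is from time -1 to time 0, where \<open>x\<close> is replaced by
    \<open>x'\<close>. The past forces the shadowing point to be \<open>x\<close>, the future then
    forces \<open>x' = x\<close>.\<close>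
  define xs where "xs n = (if n < 0 then int_iter f n x else int_iter f n x')" for n
  have step: "f (int_iter f n y) = int_iter f (n + 1) y" for n y
    using int_iter_nat_add[OF bij, of n 1 y] by simp
  have "pseudo_orbit f \<delta> xs"
    unfolding pseudo_orbit_def
  proof
    fix n :: int
    show "dist (f (xs n)) (xs (n + 1)) < \<delta> (f (xs n))"
    proof (cases "n = -1")
      case True
      then show ?thesis using x' by (simp add: xs_def step int_iter_def[of _ 0] dist_commute)
    next
      case False
      then have "f (xs n) = xs (n + 1)" by (auto simp: xs_def step)
      then show ?thesis using \<delta>0 by simp
    qed
  qed
  then obtain y where y: "\<And>n. dist (int_iter f n y) (xs n) < \<epsilon> (xs n)"
    using \<delta>(2) unfolding shadowed_def by blast
  have \<epsilon>_orb: "\<epsilon> (orb n) \<le> \<eta> n / 2" for n using \<epsilon>_le[of "orb n" n] by simp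
  have eqI: "w = x" if "\<And>k::nat. dist w x \<le> 1 / (1 + real k)" for w
  proof (rule ccontr)
    assume "w \<noteq> x"
    then obtain k :: nat where "1 / real (Suc k) < dist w x"
      using nat_approx_posE[of "dist w x"] by auto
    then show False using that[of k] by (simp add: algebra_simps)
  qed
  have "y = x"
  proof (rule eqI)
    fix k :: nat
    have "dist (int_iter f (- int (Suc k)) y) (orb (- int (Suc k))) < \<epsilon> (orb (- int (Suc k)))"
      using y[of "- int (Suc k)"] by (simp add: xs_def orb_def)
    also have "\<dots> \<le> \<eta> (- int (Suc k))" using \<epsilon>_orb[of "- int (Suc k)"] \<eta>0[of "- int (Suc k)"] by linarith
    finally have "dist y x < 1 / (1 + \<bar>real_of_int (- int (Suc k))\<bar>)"
      using \<eta> cancel[of "- int (Suc k)" y] by metis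
    also have "\<dots> \<le> 1 / (1 + real k)" by (simp add: field_simps)
    finally show "dist y x \<le> 1 / (1 + real k)" by simp
  qed
  have "x' = x"
  proof (rule eqI)
    fix k :: nat
    let ?w = "int_iter f (int k) x'"
    have "dist (orb (int k)) ?w < \<epsilon> ?w"
      using y[of "int k"] \<open>y = x\<close> by (simp add: xs_def orb_def)
    then have "dist ?w (orb (int k)) < \<eta> (int k)"
      using lip[of ?w "orb (int k)"] \<epsilon>_orb[of "int k"] by (simp add: dist_commute)
    then have "dist x' x < 1 / (1 + \<bar>real_of_int (int k)\<bar>)"
      using \<eta> cancel[of "int k" x'] by metis
    then show "dist x' x \<le> 1 / (1 + real k)" by simp
  qed
  with x' show False by simp
qed

section \<open>Orientation preserving homeomorphisms in terms of logarithms\<close>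

text \<open>Having a continuous logarithm, the quotient \<open>(f p - f q) / (p - q)\<close> does not wind around 0 as
  \<open>p\<close> moves around \<open>q\<close>: the local degree of \<open>f\<close> at \<open>q\<close> is 1.\<close>

definition positive_degree :: "(complex \<Rightarrow> complex) \<Rightarrow> bool" where
  "positive_degree f \<longleftrightarrow>
     (\<forall>q. \<exists>m. continuous_on (- {q}) m \<and> (\<forall>p. p \<noteq> q \<longrightarrow> f p - f q = (p - q) * exp (m p)))"

text \<open>The difference quotient of a composition is a product, so the logarithms add;
  injectivity of \<open>h\<close> keeps \<open>h p\<close> away from \<open>h q\<close>, where the
  outer logarithm is undefined.\<close>

lemma positive_degree_compose:
  assumes f: "positive_degree f" and h: "positive_degree h"
    and inj: "inj h" and cont: "continuous_on UNIV h"
  shows "positive_degree (f \<circ> h)"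
  unfolding positive_degree_def
proof
  fix q
  obtain m where m: "continuous_on (- {q}) m" "\<And>p. p \<noteq> q \<Longrightarrow> h p - h q = (p - q) * exp (m p)"
    using h unfolding positive_degree_def by blast
  obtain m' where m': "continuous_on (- {h q}) m'"
    "\<And>p. p \<noteq> h q \<Longrightarrow> f p - f (h q) = (p - h q) * exp (m' p)"
    using f unfolding positive_degree_def by blast
  have ne: "h p \<noteq> h q" if "p \<noteq> q" for p using inj that by (auto dest: injD)
  show "\<exists>m. continuous_on (- {q}) m \<and>
      (\<forall>p. p \<noteq> q \<longrightarrow> (f \<circ> h) p - (f \<circ> h) q = (p - q) * exp (m p))"
  proof (intro exI conjI allI impI)
    show "continuous_on (- {q}) (\<lambda>p. m p + m' (h p))"
      by (intro continuous_intros m continuous_on_compose2[OF m'(1)]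
          continuous_on_subset[OF cont]) (use inj in \<open>auto dest: injD\<close>)
    fix p assume "p \<noteq> q"
    then show "(f \<circ> h) p - (f \<circ> h) q = (p - q) * exp (m p + m' (h p))"
      using m(2) m'(2)[OF ne] by (simp add: exp_add)
  qed
qed

text \<open>The radial retraction onto a circle around \<open>q\<close> is homotopic to the identity
  of the punctured plane, and having a continuous logarithm is the same as being homotopic to a
  constant in the nonzero numbers.\<close>

lemma continuous_logarithm_punctured_plane:
  fixes \<phi> :: "complex \<Rightarrow> complex"
  assumes cont: "continuous_on (- {q}) \<phi>" and nz: "\<And>p. p \<noteq> q \<Longrightarrow> \<phi> p \<noteq> 0" and R: "R > 0"
    and l: "continuous_on (sphere q R) l" "\<And>p. p \<in> sphere q R \<Longrightarrow> \<phi> p = exp (l p)"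
  obtains m where "continuous_on (- {q}) m" "\<And>p. p \<noteq> q \<Longrightarrow> \<phi> p = exp (m p)"
proof -
  define \<rho> where "\<rho> p = q + (R / norm (p - q)) *\<^sub>R (p - q)" for p
  have cont\<rho>: "continuous_on (- {q}) \<rho>"
    unfolding \<rho>_def by (intro continuous_intros) auto
  have im\<rho>: "\<rho> p \<in> sphere q R" if "p \<noteq> q" for p
    using that R by (simp add: \<rho>_def dist_norm)
  have "homotopic_with_canon (\<lambda>_. True) (- {q}) (- {q}) id \<rho>"
  proof (rule homotopic_with_linear)
    fix p assume "p \<in> - {q}"
    then have pq: "p \<noteq> q" by simp
    show "closed_segment (id p) (\<rho> p) \<subseteq> - {q}"
    proof
      fix w assume "w \<in> closed_segment (id p) (\<rho> p)"
      then obtain t where t: "0 \<le> t" "t \<le> 1" "w = (1 - t) *\<^sub>R p + t *\<^sub>R \<rho> p"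
        by (auto simp: closed_segment_def)
      define c where "c = (1 - t) + t * (R / norm (p - q))"
      have "w - q = c *\<^sub>R (p - q)"
        by (simp add: t \<rho>_def c_def algebra_simps)
      moreover have "c > 0"
      proof (cases "t = 1")
        case False
        then show ?thesis unfolding c_def using t R by (intro add_pos_nonneg) auto
      qed (use R pq in \<open>simp add: c_def\<close>)
      ultimately show "w \<in> - {q}" using pq by auto
    qed
  qed (use cont\<rho> in auto)
  then have 1: "homotopic_with_canon (\<lambda>_. True) (- {q}) (- {0}) (\<phi> \<circ> id) (\<phi> \<circ> \<rho>)"
    by (rule homotopic_with_compose_continuous_left) (use cont nz in auto)
  have "\<exists>g. continuous_on (- {q}) g \<and> (\<forall>p\<in>- {q}. (\<phi> \<circ> \<rho>) p = exp (g p))"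
    using im\<rho> by (intro exI[of _ "l \<circ> \<rho>"] conjI continuous_on_compose cont\<rho> continuous_on_subset[OF l(1)])
      (auto simp: l(2) simp del: mem_sphere)
  then obtain a where "homotopic_with_canon (\<lambda>_. True) (- {q}) (- {0}) (\<phi> \<circ> \<rho>) (\<lambda>_. a)"
    using inessential_eq_continuous_logarithm by blast
  then have "homotopic_with_canon (\<lambda>_. True) (- {q}) (- {0}) \<phi> (\<lambda>_. a)"
    using 1 homotopic_with_trans by fastforce
  then obtain m where "continuous_on (- {q}) m" "\<forall>p\<in>- {q}. \<phi> p = exp (m p)"
    using inessential_eq_continuous_logarithm by blast
  then show ?thesis by (intro that) auto
qed

text \<open>One circle around each \<open>q\<close> suffices, and its radius is free: a compactly
  supported map is tested on a large circle, an orientation preserving one on the unit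
  circle.\<close>

lemma positive_degreeI:
  assumes cont: "continuous_on UNIV f" and inj: "inj f"
    and log: "\<And>q. \<exists>R>0. \<exists>l. continuous_on (sphere q R) l \<and>
      (\<forall>p\<in>sphere q R. (f p - f q) / (p - q) = exp (l p))"
  shows "positive_degree f"
  unfolding positive_degree_def
proof
  fix q
  obtain R l where R: "R > 0" and l: "continuous_on (sphere q R) l"
    "\<And>p. p \<in> sphere q R \<Longrightarrow> (f p - f q) / (p - q) = exp (l p)"
    using log[of q] by blast
  have 1: "continuous_on (- {q}) (\<lambda>p. (f p - f q) / (p - q))"
    by (intro continuous_intros continuous_on_subset[OF cont]) auto
  have 2: "(f p - f q) / (p - q) \<noteq> 0" if "p \<noteq> q" for p
    using inj that by (auto dest: injD)
  obtain m where "continuous_on (- {q}) m" "\<And>p. p \<noteq> q \<Longrightarrow> (f p - f q) / (p - q) = exp (m p)"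
    using continuous_logarithm_punctured_plane[OF 1 2 R l] by blast
  then show "\<exists>m. continuous_on (- {q}) m \<and> (\<forall>p. p \<noteq> q \<longrightarrow> f p - f q = (p - q) * exp (m p))"
    by (intro exI[of _ m]) (simp add: divide_eq_eq mult.commute)
qed

lemma positive_degree_compact_support:
  assumes cont: "continuous_on UNIV h" and inj: "inj h" and bdd: "bounded {x. h x \<noteq> x}"
  shows "positive_degree h"
proof (rule positive_degreeI[OF cont inj])
  fix q
  obtain B where B: "\<And>x. h x \<noteq> x \<Longrightarrow> norm x \<le> B" and B0: "B > 0"
    using bdd unfolding bounded_pos by auto
  \<comment> \<open>On this circle \<open>h\<close> is the identity, and
    \<open>norm (h q - q) < R\<close> puts the quotient within distance 1 of 1, where the principal
    branch is continuous.\<close>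
  define R where "R = B + norm q + norm (h q - q) + 1"
  have R0: "R > 0" using B0 unfolding R_def by (smt (verit) norm_ge_zero)
  have *: "(h p - h q) / (p - q) \<notin> \<real>\<^sub>\<le>\<^sub>0 \<and> (h p - h q) / (p - q) \<noteq> 0" if "p \<in> sphere q R" for p
  proof -
    have pq: "norm (p - q) = R" using that by (simp add: dist_norm norm_minus_commute)
    have "norm p > B" using pq norm_triangle_ineq4[of p q] unfolding R_def
      by (smt (verit) norm_ge_zero)
    then have hp: "h p = p" using B by fastforce
    have ne: "p - q \<noteq> 0" using pq R0 by auto
    have "norm ((h p - h q) / (p - q) - 1) = norm ((q - h q) / (p - q))"
      using ne hp by (simp add: divide_simps)
    also have "\<dots> = norm (h q - q) / R" by (simp add: norm_divide pq norm_minus_commute)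
    also have "\<dots> < 1" using R0 B0 unfolding R_def by (simp add: divide_simps) (smt (verit) norm_ge_zero)
    finally have n: "norm ((h p - h q) / (p - q) - 1) < 1" .
    have "Re ((h p - h q) / (p - q)) > 0"
      using n abs_Re_le_cmod[of "(h p - h q) / (p - q) - 1"] by simp
    then show ?thesis by (auto simp: complex_nonpos_Reals_iff)
  qed
  show "\<exists>R>0. \<exists>l. continuous_on (sphere q R) l \<and> (\<forall>p\<in>sphere q R. (h p - h q) / (p - q) = exp (l p))"
  proof (intro exI conjI ballI)
    show "R > 0" by fact
    show "continuous_on (sphere q R) (\<lambda>p. Ln ((h p - h q) / (p - q)))"
      using * R0 by (intro continuous_intros continuous_on_subset[OF cont]) auto
    fix p assume "p \<in> sphere q R"
    then show "(h p - h q) / (p - q) = exp (Ln ((h p - h q) / (p - q)))" using * by simp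
  qed
qed

section \<open>Transfer between \<open>real^2\<close> and \<open>complex\<close>\<close>

definition vec_of_complex :: "complex \<Rightarrow> real^2" where
  "vec_of_complex z = vector [Re z, Im z]"

definition complex_of_vec :: "real^2 \<Rightarrow> complex" where
  "complex_of_vec v = Complex (v $ 1) (v $ 2)"

lemma complex_of_vec_inverse [simp]: "complex_of_vec (vec_of_complex z) = z"
  by (simp add: complex_of_vec_def vec_of_complex_def)

lemma vec_of_complex_inverse [simp]: "vec_of_complex (complex_of_vec v) = v"
  by (simp add: complex_of_vec_def vec_of_complex_def vec_eq_iff forall_2)

lemma norm_complex_of_vec [simp]: "norm (complex_of_vec v) = norm v"
  by (simp add: complex_of_vec_def norm_vec_def L2_set_def sum_2 cmod_def)

lemma norm_vec_of_complex [simp]: "norm (vec_of_complex z) = norm z"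
  by (metis complex_of_vec_inverse norm_complex_of_vec)

lemma complex_of_vec_diff: "complex_of_vec (v - w) = complex_of_vec v - complex_of_vec w"
  by (simp add: complex_of_vec_def complex_eq_iff)

lemma complex_of_vec_scaleR: "complex_of_vec (c *\<^sub>R v) = c *\<^sub>R complex_of_vec v"
  by (simp add: complex_of_vec_def complex_eq_iff)

lemma vec_of_complex_add: "vec_of_complex (z + w) = vec_of_complex z + vec_of_complex w"
  by (simp add: vec_of_complex_def vec_eq_iff forall_2)

lemma vec_of_complex_diff: "vec_of_complex (z - w) = vec_of_complex z - vec_of_complex w"
  by (simp add: vec_of_complex_def vec_eq_iff forall_2)

lemma continuous_on_complex_of_vec [continuous_intros]:
  "continuous_on S h \<Longrightarrow> continuous_on S (\<lambda>x. complex_of_vec (h x))"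
proof -
  have "continuous_on UNIV complex_of_vec"
    by (simp add: continuous_on_iff dist_norm flip: complex_of_vec_diff) blast
  then show "continuous_on S h \<Longrightarrow> continuous_on S (\<lambda>x. complex_of_vec (h x))"
    by (rule continuous_on_compose2) auto
qed

lemma continuous_on_vec_of_complex [continuous_intros]:
  "continuous_on S h \<Longrightarrow> continuous_on S (\<lambda>x. vec_of_complex (h x))"
proof -
  have "continuous_on UNIV vec_of_complex"
    by (simp add: continuous_on_iff dist_norm flip: vec_of_complex_diff) blast
  then show "continuous_on S h \<Longrightarrow> continuous_on S (\<lambda>x. vec_of_complex (h x))"
    by (rule continuous_on_compose2) auto
qed

text \<open>Dividing the given homotopy by \<open>z\<close> deforms the normalized difference
  quotient to 1, so it has a logarithm; adding the real logarithm of the modulus undoes the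
  normalization.\<close>

lemma orientation_preserving_imp_positive_degree:
  fixes f :: "real^2 \<Rightarrow> real^2"
  assumes op: "orientation_preserving f" and cont: "continuous_on UNIV f" and inj: "inj f"
  shows "positive_degree (complex_of_vec \<circ> f \<circ> vec_of_complex)" (is "positive_degree ?F")
proof (rule positive_degreeI)
  show contF: "continuous_on UNIV ?F"
    unfolding o_def by (intro continuous_intros continuous_on_compose2[OF cont]) auto
  show injF: "inj ?F"
    by (intro inj_compose inj) (metis vec_of_complex_inverse injI, metis complex_of_vec_inverse injI)
  fix q
  define N where "N z = (1 / norm (?F (q + z) - ?F q)) *\<^sub>R (?F (q + z) - ?F q)" for z
  have "homotopic_with_canon (\<lambda>_. True) (sphere 0 1) (sphere 0 1)
     (\<lambda>z. (1 / norm (f (vec_of_complex q + z) - f (vec_of_complex q))) *\<^sub>R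
        (f (vec_of_complex q + z) - f (vec_of_complex q))) id" (is "homotopic_with_canon _ _ _ ?n id")
    using op[unfolded orientation_preserving_def, rule_format, of 1 "vec_of_complex q"] by simp
  then have "homotopic_with_canon (\<lambda>_. True) (sphere 0 1) (sphere 0 1) (?n \<circ> vec_of_complex) (id \<circ> vec_of_complex)"
    by (rule homotopic_with_compose_continuous_right) (auto intro: continuous_on_vec_of_complex[OF continuous_on_id])
  then have "homotopic_with_canon (\<lambda>_. True) (sphere 0 1) (sphere 0 1)
     (complex_of_vec \<circ> (?n \<circ> vec_of_complex)) (complex_of_vec \<circ> (id \<circ> vec_of_complex))"
    by (rule homotopic_with_compose_continuous_left) (auto intro: continuous_on_complex_of_vec[OF continuous_on_id])
  moreover have "complex_of_vec \<circ> (?n \<circ> vec_of_complex) = N"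
    by (auto simp: N_def fun_eq_iff complex_of_vec_scaleR vec_of_complex_add simp flip: complex_of_vec_diff)
  moreover have "complex_of_vec \<circ> (id \<circ> vec_of_complex) = id" by auto
  ultimately have "homotopic_with_canon (\<lambda>_. True) (sphere 0 1) (sphere 0 1) N id" by simp
  then obtain k where k: "continuous_on ({0..1} \<times> sphere 0 1) k"
    "k \<in> ({0..1} \<times> sphere 0 1) \<rightarrow> sphere 0 1" "\<And>z. k (0::real, z) = N z" "\<And>z. k (1, z) = z"
    by (auto simp: homotopic_with_def)
  \<comment> \<open>The end map of the homotopy must be right at every argument, and
    \<open>z / z\<close> is 0 at \<open>z = 0\<close>; on the circle it is the constant 1.\<close>
  have "homotopic_with_canon (\<lambda>_. True) (sphere 0 1) (- {0}) (\<lambda>z. N z / z) (\<lambda>z. if z = 0 then 0 else 1)"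
    unfolding homotopic_with_def
  proof (intro exI[of _ "\<lambda>x. k x / snd x"] conjI allI ballI)
    have "continuous_on ({0..1} \<times> sphere 0 1) (\<lambda>x. k x / snd x)"
      by (intro continuous_intros k) auto
    moreover have "k x / snd x \<noteq> 0" if "x \<in> {0..1} \<times> sphere 0 1" for x
      using k(2) that by force
    ultimately show "continuous_map (prod_topology (top_of_set {0..1}) (top_of_set (sphere 0 1)))
        (top_of_set (- {0})) (\<lambda>x. k x / snd x)"
      by auto
  qed (auto simp: k)
  moreover have "homotopic_with_canon (\<lambda>_. True) (sphere 0 1) (- {0}) (\<lambda>z::complex. if z = 0 then 0 else 1) (\<lambda>z. 1::complex)"
    by (rule homotopic_with_equal) (auto intro!: continuous_on_eq[OF continuous_on_const[of _ 1]])
  ultimately have "homotopic_with_canon (\<lambda>_. True) (sphere 0 1) (- {0}) (\<lambda>z. N z / z) (\<lambda>z. 1)"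
    by (rule homotopic_with_trans)
  then have "\<exists>l. continuous_on (sphere 0 1) l \<and> (\<forall>z\<in>sphere 0 1. N z / z = exp (l z))"
    using inessential_eq_continuous_logarithm[of "sphere 0 1" "\<lambda>z. N z / z"] by blast
  then obtain l where l: "continuous_on (sphere 0 1) l" "\<And>z. z \<in> sphere 0 1 \<Longrightarrow> N z / z = exp (l z)"
    by blast
  have ne: "?F p - ?F q \<noteq> 0" if "p \<in> sphere q 1" for p
  proof
    assume "?F p - ?F q = 0"
    then have "?F p = ?F q" by (simp only: right_minus_eq)
    then have "p = q" by (rule injD[OF injF])
    with that show False by simp
  qed
  show "\<exists>R>0. \<exists>l. continuous_on (sphere q R) l \<and> (\<forall>p\<in>sphere q R. (?F p - ?F q) / (p - q) = exp (l p))"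
  proof (intro exI[of _ 1] conjI exI ballI)
    have im: "p - q \<in> sphere 0 1" if "p \<in> sphere q 1" for p
      using that by (simp add: dist_norm norm_minus_commute)
    show "continuous_on (sphere q 1) (\<lambda>p. complex_of_real (ln (norm (?F p - ?F q))) + l (p - q))"
    proof (intro continuous_on_add continuous_on_of_real continuous_on_ln continuous_on_norm
        continuous_on_diff continuous_on_const continuous_on_subset[OF contF] ballI)
      show "continuous_on (sphere q 1) (\<lambda>p. l (p - q))"
        using im by (intro continuous_on_compose2[OF l(1)] continuous_intros) auto
    qed (use ne in \<open>auto simp only: norm_eq_zero\<close>)
    fix p assume p: "p \<in> sphere q 1"
    have "exp (complex_of_real (ln (norm (?F p - ?F q))) + l (p - q))
        = complex_of_real (norm (?F p - ?F q)) * (N (p - q) / (p - q))"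
      unfolding exp_add l(2)[OF im[OF p]] exp_of_real using ne[OF p] by simp
    also have "\<dots> = (?F p - ?F q) / (p - q)"
      using ne[OF p] by (simp add: N_def scaleR_conv_of_real)
    finally show "(?F p - ?F q) / (p - q) = exp (complex_of_real (ln (norm (?F p - ?F q))) + l (p - q))" ..
  qed simp
qed

section \<open>Homeomorphisms exchanging two points\<close>

text \<open>Brouwer's theorem applies to \<open>G\<close> clamped to the rectangle. At a fixed point
  of the clamped map the boundary inequalities rule out that a coordinate was really cut
  off.\<close>

lemma Poincare_Miranda_complex:
  fixes G :: "complex \<Rightarrow> complex"
  assumes cont: "continuous_on UNIV G" and N: "N > 0" and L: "L > 0"
    and right: "\<And>u. Re u = N \<Longrightarrow> Re (G u) < N" and left: "\<And>u. Re u = - N \<Longrightarrow> Re (G u) > - N"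
    and top: "\<And>u. \<bar>Re u\<bar> \<le> N \<Longrightarrow> Im u = L \<Longrightarrow> Im (G u) < L"
    and bot: "\<And>u. \<bar>Re u\<bar> \<le> N \<Longrightarrow> Im u = - L \<Longrightarrow> Im (G u) > - L"
  obtains u where "G u = u"
proof -
  define S where "S = cbox (Complex (- N) (- L)) (Complex N L)"
  define h where "h u = Complex (max (- N) (min N (Re (G u)))) (max (- L) (min L (Im (G u))))" for u
  have memS: "u \<in> S \<longleftrightarrow> \<bar>Re u\<bar> \<le> N \<and> \<bar>Im u\<bar> \<le> L" for u
    unfolding S_def in_cbox_complex_iff by auto
  have "continuous_on S h"
    unfolding h_def Complex_eq by (intro continuous_intros continuous_on_subset[OF cont]) auto
  moreover have "h \<in> S \<rightarrow> S" using N L by (auto simp: memS h_def)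
  moreover have "S \<noteq> {}" using memS[of 0] N L by auto
  ultimately obtain u where u: "u \<in> S" "h u = u"
    using brouwer[of S h] unfolding S_def by (auto simp: compact_cbox)
  have uS: "\<bar>Re u\<bar> \<le> N" "\<bar>Im u\<bar> \<le> L" using u(1) memS by auto
  have "Re u = max (- N) (min N (Re (G u)))" "Im u = max (- L) (min L (Im (G u)))"
    using u(2) by (auto simp: h_def complex_eq_iff)
  then have "Re (G u) = Re u" "Im (G u) = Im u"
    using right[of u] left[of u] top[of u] bot[of u] uS N L by (auto simp: max_def min_def split: if_splits)
  then show ?thesis by (intro that[of u]) (simp add: complex_eq_iff)
qed

lemma filterlim_at_infinity_homeomorphism:
  fixes f :: "complex \<Rightarrow> complex"
  assumes "homeomorphism UNIV UNIV f g"
  shows "filterlim f at_infinity at_infinity"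
  unfolding filterlim_at_infinity[OF order_refl]
proof (intro allI impI)
  fix r :: real assume "r > 0"
  have "continuous_on (cball 0 r) g"
    using assms by (meson continuous_on_subset homeomorphism_def subset_UNIV)
  then have "bounded (g ` cball 0 r)"
    by (intro compact_imp_bounded compact_continuous_image) auto
  then obtain R where R: "\<And>z. z \<in> g ` cball 0 r \<Longrightarrow> norm z \<le> R" unfolding bounded_iff by blast
  show "\<forall>\<^sub>F z in at_infinity. r \<le> norm (f z)"
    unfolding eventually_at_infinity
  proof (intro exI[of _ "R + 1"] allI impI)
    fix z :: complex assume "R + 1 \<le> norm z"
    then have "z \<notin> g ` cball 0 r" using R by force
    moreover have "z = g (f z)" using assms by (simp add: homeomorphism_def)
    ultimately show "r \<le> norm (f z)" by (metis image_eqI linear mem_cball_0)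
  qed
qed

text \<open>\<open>H\<close> differs from the principal logarithm of \<open>exp H\<close> by an
  integer multiple of 2 pi i. Outside a large disc this integer depends continuously on the point,
  and the complement of a disc in the plane is connected.\<close>

lemma tendsto_logarithm_at_infinity:
  fixes H :: "complex \<Rightarrow> complex"
  assumes cont: "continuous_on (- cball 0 R) H" and lim: "((\<lambda>z. exp (H z)) \<longlongrightarrow> 1) at_infinity"
  obtains m :: int where "(H \<longlongrightarrow> of_int m * (2 * of_real pi * \<i>)) at_infinity"
proof -
  have "\<forall>\<^sub>F z in at_infinity. dist (exp (H z)) 1 < 1" using lim by (rule tendstoD) simp
  then obtain R1 where R1: "\<And>z. norm z \<ge> R1 \<Longrightarrow> dist (exp (H z)) 1 < 1"
    unfolding eventually_at_infinity by blast
  define R2 where "R2 = max R R1"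
  let ?S = "- cball (0::complex) R2"
  have contS: "continuous_on ?S H"
    by (rule continuous_on_subset[OF cont]) (auto simp: R2_def)
  have pos: "exp (H z) \<notin> \<real>\<^sub>\<le>\<^sub>0" if "z \<in> ?S" for z
  proof -
    have "norm (exp (H z) - 1) < 1" using R1[of z] that by (auto simp: R2_def dist_norm)
    then have "Re (exp (H z)) > 0" using abs_Re_le_cmod[of "exp (H z) - 1"] by simp
    then show ?thesis by (auto simp: complex_nonpos_Reals_iff)
  qed
  define D where "D z = (H z - Ln (exp (H z))) / (2 * of_real pi * \<i>)" for z
  have contD: "continuous_on ?S D"
    unfolding D_def using pos by (intro continuous_intros contS) auto
  have D_int: "\<exists>n::int. D z = of_int n" for z
  proof -
    have "exp (H z) = exp (Ln (exp (H z)))" by simp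
    then obtain n :: int where "H z = Ln (exp (H z)) + of_int (2 * n) * (of_real pi * \<i>)"
      unfolding exp_eq by (auto simp: algebra_simps)
    then have "D z = of_int n" by (simp add: D_def field_simps)
    then show ?thesis ..
  qed
  have "D constant_on ?S"
  proof (rule continuous_discrete_range_constant[OF _ contD])
    show "connected ?S"
      by (rule connected_complement_bounded_convex) auto
    fix x assume "x \<in> ?S"
    have "1 \<le> norm (D y - D x)" if "D y \<noteq> D x" for y
    proof -
      obtain i j :: int where "D y = of_int i" "D x = of_int j" using D_int by metis
      moreover have "norm (of_int i - of_int j :: complex) = \<bar>of_int (i - j)\<bar>"
        by (metis norm_of_int of_int_diff)
      ultimately show ?thesis using that by auto
    qed
    then show "\<exists>e>0. \<forall>y. y \<in> ?S \<and> D y \<noteq> D x \<longrightarrow> e \<le> norm (D y - D x)"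
      using zero_less_one by blast
  qed
  then obtain d where d: "\<And>z. z \<in> ?S \<Longrightarrow> D z = d" unfolding constant_on_def by blast
  have "of_real (\<bar>R2\<bar> + 1) \<in> ?S" by simp
  then obtain m :: int where m: "d = of_int m" using d D_int by metis
  have "((\<lambda>z. Ln (exp (H z)) + of_int m * (2 * of_real pi * \<i>)) \<longlongrightarrow> Ln 1 + of_int m * (2 * of_real pi * \<i>)) at_infinity"
    by (intro tendsto_intros lim) auto
  moreover have "\<forall>\<^sub>F z in at_infinity. Ln (exp (H z)) + of_int m * (2 * of_real pi * \<i>) = H z"
    unfolding eventually_at_infinity
  proof (intro exI[of _ "R2 + 1"] allI impI)
    fix z :: complex assume "R2 + 1 \<le> norm z"
    then have "D z = of_int m" using d[of z] m by simp
    then show "Ln (exp (H z)) + of_int m * (2 * of_real pi * \<i>) = H z"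
      by (simp add: D_def field_simps)
  qed
  ultimately have "(H \<longlongrightarrow> Ln 1 + of_int m * (2 * of_real pi * \<i>)) at_infinity"
    using Lim_transform_eventually by blast
  then show ?thesis using that by simp
qed

text \<open>If \<open>f\<close> exchanges \<open>a\<close> and \<open>b\<close>, it acts on the annulus \<open>\<complex> \<union> {\<infinity>} - {a, b}\<close>, and lifts to
  the universal cover with coordinate \<open>u = log ((z - a) / (z - b))\<close> as a map which reverses both
  directions. Hence each lift has a fixed point by the Poincare-Miranda theorem, and for one out
  of two lifts this fixed point does not lie over \<open>\<infinity>\<close>.\<close>

lemma exchanged_points_imp_fixed_point:
  assumes homeo: "homeomorphism UNIV UNIV f g" and pd: "positive_degree f"
    and ab: "a \<noteq> b" and fa: "f a = b" and fb: "f b = a"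
  shows "\<exists>z. f z = z"
proof -
  have contf: "continuous_on UNIV f" using homeo by (simp add: homeomorphism_def)
  have inj: "f x = f y \<longleftrightarrow> x = y" for x y using homeo by (metis UNIV_I homeomorphism_def)
  obtain ma where ma: "continuous_on (- {a}) ma" "\<And>p. p \<noteq> a \<Longrightarrow> f p - b = (p - a) * exp (ma p)"
    using pd fa unfolding positive_degree_def by metis
  obtain mb where mb: "continuous_on (- {b}) mb" "\<And>p. p \<noteq> b \<Longrightarrow> f p - a = (p - b) * exp (mb p)"
    using pd fb unfolding positive_degree_def by metis
  \<comment> \<open>With \<open>u\<close> the logarithmic coordinate, \<open>H z\<close> is a branch
    of \<open>u (f z) + u z\<close>. It is single-valued thanks to the positive degree at both
    points, and \<open>H - u\<close> is the lift that reverses directions.\<close>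
  define H where "H z = mb z - ma z" for z
  have contH: "continuous_on (- {a, b}) H"
    unfolding H_def by (intro continuous_intros continuous_on_subset[OF ma(1)] continuous_on_subset[OF mb(1)]) auto
  have expH: "exp (H z) = ((f z - a) / (f z - b)) * ((z - a) / (z - b))" if "z \<noteq> a" "z \<noteq> b" for z
    using that by (simp add: H_def exp_diff ma(2) mb(2))
  have to_1: "((\<lambda>w. (w - p) / (w - q)) \<longlongrightarrow> 1) at_infinity" for p q :: complex
  proof -
    have "((\<lambda>w. 1 + (q - p) / (w - q)) \<longlongrightarrow> 1 + 0) at_infinity"
    proof (intro tendsto_intros tendsto_divide_0[OF tendsto_const])
      show "filterlim (\<lambda>w. w - q) at_infinity at_infinity"
        using tendsto_add_filterlim_at_infinity'[OF filterlim_ident tendsto_const[of "- q"]] by simp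
    qed
    moreover have "\<forall>\<^sub>F w in at_infinity. 1 + (q - p) / (w - q) = (w - p) / (w - q)"
      unfolding eventually_at_infinity
    proof (intro exI[of _ "norm q + 1"] allI impI)
      fix w :: complex assume "norm q + 1 \<le> norm w"
      then have "w \<noteq> q" by auto
      then show "1 + (q - p) / (w - q) = (w - p) / (w - q)" by (simp add: field_simps)
    qed
    ultimately show ?thesis using Lim_transform_eventually by fastforce
  qed
  define R where "R = max (norm a) (norm b)"
  have far: "z \<noteq> a" "z \<noteq> b" if "z \<in> - cball 0 R" for z using that by (auto simp: R_def)
  have "((\<lambda>z. ((f z - a) / (f z - b)) * ((z - a) / (z - b))) \<longlongrightarrow> 1 * 1) at_infinity"
    using filterlim_at_infinity_homeomorphism[OF homeo]
    by (intro tendsto_mult to_1 filterlim_compose[OF to_1])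
  moreover have "\<forall>\<^sub>F z in at_infinity. ((f z - a) / (f z - b)) * ((z - a) / (z - b)) = exp (H z)"
    unfolding eventually_at_infinity
  proof (intro exI[of _ "R + 1"] allI impI)
    fix z :: complex assume "R + 1 \<le> norm z"
    then show "((f z - a) / (f z - b)) * ((z - a) / (z - b)) = exp (H z)"
      using far[of z] by (simp add: expH)
  qed
  ultimately have "((\<lambda>z. exp (H z)) \<longlongrightarrow> 1) at_infinity"
    using Lim_transform_eventually by fastforce
  moreover have "continuous_on (- cball 0 R) H"
    by (rule continuous_on_subset[OF contH]) (use far in auto)
  ultimately obtain m :: int where m: "(H \<longlongrightarrow> of_int m * (2 * of_real pi * \<i>)) at_infinity"
    using tendsto_logarithm_at_infinity by blast

  \<comment> \<open>Inverse of the Moebius map \<open>(z - a) / (z - b)\<close>: the values 0, 1 and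
    infinity of \<open>w\<close> correspond to \<open>a\<close>, infinity and
    \<open>b\<close>.\<close>
  define Z where "Z w = (a - b * w) / (1 - w)" for w
  have Za: "Z w - a = (a - b) * w / (1 - w)" if "w \<noteq> 1" for w
    using that by (simp add: Z_def field_simps)
  have Zb: "Z w - b = (a - b) / (1 - w)" if "w \<noteq> 1" for w
    using that by (simp add: Z_def field_simps)
  have Zne: "Z w \<noteq> a" "Z w \<noteq> b" if "w \<noteq> 1" "w \<noteq> 0" for w
    using Za[OF that(1)] Zb[OF that(1)] that ab by auto
  have Zratio: "(Z w - a) / (Z w - b) = w" if "w \<noteq> 1" for w
    using that ab by (simp add: Za Zb)
  \<comment> \<open>\<open>H\<close> in the coordinate \<open>w\<close>, extended over the point
    \<open>w = 1\<close> at infinity by its limit.\<close>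
  define \<kappa> where "\<kappa> w = (if w = 1 then of_int m * (2 * of_real pi * \<i>) else H (Z w))" for w
  have cont\<kappa>: "continuous_on (- {0}) \<kappa>"
  proof -
    have "isCont \<kappa> w" if "w \<noteq> 0" for w
    proof (cases "w = 1")
      case True
      have "filterlim (\<lambda>w. 1 - w) (at 0) (at (1::complex))"
        unfolding filterlim_at by (auto intro!: tendsto_eq_intros simp: eventually_at_filter)
      moreover have "((\<lambda>w. a - b * w) \<longlongrightarrow> a - b) (at 1)"
        by (auto intro!: tendsto_eq_intros)
      ultimately have "filterlim Z at_infinity (at 1)"
        unfolding Z_def using ab by (intro filterlim_divide_at_infinity) auto
      then have "((\<lambda>w. H (Z w)) \<longlongrightarrow> of_int m * (2 * of_real pi * \<i>)) (at 1)"
        by (rule filterlim_compose[OF m])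
      then have "(\<kappa> \<longlongrightarrow> of_int m * (2 * of_real pi * \<i>)) (at 1)"
        by (rule Lim_transform_eventually) (auto simp: \<kappa>_def eventually_at_filter)
      then show ?thesis by (simp add: True isCont_def \<kappa>_def)
    next
      case False
      have "continuous_on (- {0, 1}) (\<lambda>w. H (Z w))"
        using Zne unfolding Z_def
        by (intro continuous_on_compose2[OF contH] continuous_intros) (auto simp: Z_def)
      then have "continuous_on (- {0, 1}) \<kappa>"
        by (rule continuous_on_eq) (auto simp: \<kappa>_def)
      moreover have "open (- {0, 1 :: complex})" by (simp add: open_Compl)
      ultimately show ?thesis using False that continuous_on_eq_continuous_at by fastforce
    qed
    then show ?thesis by (intro continuous_at_imp_continuous_on) auto
  qed
  \<comment> \<open>A fixed point of \<open>G\<close> over infinity would be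
    \<open>u = 2 k pi i\<close> with \<open>2 * k = m + j\<close>; this choice makes
    \<open>m + j\<close> odd.\<close>
  define j :: int where "j = (if even m then 1 else 0)"
  define G where "G u = \<kappa> (exp u) - u + of_int j * (2 * of_real pi * \<i>)" for u
  have contG: "continuous_on UNIV G"
    unfolding G_def by (intro continuous_intros continuous_on_compose2[OF cont\<kappa>]) auto
  have exp_j: "exp (of_int j * (2 * complex_of_real pi * \<i>)) = 1"
    by (auto simp: j_def)
  have expG: "exp (G u) = (f (Z (exp u)) - a) / (f (Z (exp u)) - b)" if "exp u \<noteq> 1" for u
  proof -
    let ?z = "Z (exp u)"
    have "exp (G u) = exp (H ?z) / exp u"
      using that exp_j by (simp add: G_def \<kappa>_def exp_add exp_diff)
    also have "\<dots> = (f ?z - a) / (f ?z - b)"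
      using expH[of ?z] Zne[of "exp u"] Zratio[of "exp u"] that by simp
    finally show ?thesis .
  qed
  have "\<exists>d>0. \<forall>z. norm (z - b) < d \<longrightarrow> norm (f z - a) < norm (f z - b)"
  proof -
    have "isCont (\<lambda>z. norm (f z - b) - norm (f z - a)) b"
      using contf by (intro continuous_intros) (auto simp: continuous_on_eq_continuous_at)
    then obtain d where "d > 0" "\<And>z. dist z b < d \<Longrightarrow>
        dist (norm (f z - b) - norm (f z - a)) (norm (f b - b) - norm (f b - a)) < norm (a - b)"
      using ab unfolding continuous_at_eps_delta by (metis zero_less_norm_iff right_minus_eq)
    then show ?thesis
      by (intro exI[of _ d]) (fastforce simp: fb dist_norm)
  qed
  then obtain d1 where d1: "d1 > 0" "\<And>z. norm (z - b) < d1 \<Longrightarrow> norm (f z - a) < norm (f z - b)" by blast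
  have "\<exists>d>0. \<forall>z. norm (z - a) < d \<longrightarrow> norm (f z - b) < norm (f z - a)"
  proof -
    have "isCont (\<lambda>z. norm (f z - a) - norm (f z - b)) a"
      using contf by (intro continuous_intros) (auto simp: continuous_on_eq_continuous_at)
    then obtain d where "d > 0" "\<And>z. dist z a < d \<Longrightarrow>
        dist (norm (f z - a) - norm (f z - b)) (norm (f a - a) - norm (f a - b)) < norm (a - b)"
      using ab unfolding continuous_at_eps_delta by (metis zero_less_norm_iff right_minus_eq)
    then show ?thesis
      by (intro exI[of _ d]) (fastforce simp: fa dist_norm norm_minus_commute[of b a])
  qed
  then obtain d2 where d2: "d2 > 0" "\<And>z. norm (z - a) < d2 \<Longrightarrow> norm (f z - b) < norm (f z - a)" by blast
  define d where "d = min d1 d2"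
  have d: "d > 0" using d1 d2 by (simp add: d_def)
  \<comment> \<open>On the circle of radius \<open>exp N\<close> one has
    \<open>norm (1 - w) \<ge> exp N - 1 > norm (a - b) / d\<close>, so \<open>Z w\<close> is
    \<open>d\<close>-close to \<open>b\<close>. The summand 2 also makes \<open>N\<close>
    positive.\<close>
  define N where "N = ln (norm (a - b) / d + 2)"
  have q0: "norm (a - b) / d \<ge> 0" using d by simp
  have expN: "exp N = norm (a - b) / d + 2" unfolding N_def using q0 by (subst exp_ln) auto
  have N0: "N > 0" unfolding N_def using q0 by (intro ln_gt_zero) simp
  have close: "norm ((a - b) / (1 - w)) < d \<and> w \<noteq> 1" if "norm w = exp N" for w :: complex
  proof -
    have "norm (1 - w) \<ge> norm w - 1" using norm_triangle_ineq2[of w 1] by (simp add: norm_minus_commute)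
    then have *: "norm (1 - w) > norm (a - b) / d" using that expN by simp
    then have "w \<noteq> 1" using q0 by auto
    moreover have "norm (a - b) < d * norm (1 - w)" using * d by (simp add: divide_less_eq mult.commute)
    ultimately show ?thesis by (simp add: norm_divide divide_less_eq)
  qed
  \<comment> \<open>Near \<open>b\<close> the image is closer to \<open>a\<close> than to
    \<open>b\<close>, hence \<open>Re (G u) < 0\<close>.\<close>
  have right: "Re (G u) < N" if "Re u = N" for u
  proof -
    have n: "norm (exp u) = exp N" using that by simp
    have z: "norm (Z (exp u) - b) < d1" and ne: "exp u \<noteq> 1"
      using close[OF n] by (auto simp: Zb d_def)
    have nz: "f (Z (exp u)) - b \<noteq> 0" using d1(2)[OF z] by auto
    have "exp (Re (G u)) = norm (exp (G u))" by simp
    also have "\<dots> < 1" unfolding expG[OF ne] using d1(2)[OF z] nz by (simp add: norm_divide)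
    finally show ?thesis using N0 by simp
  qed
  have left: "Re (G u) > - N" if "Re u = - N" for u
  proof -
    have n: "norm (exp (- u)) = exp N" using that by simp
    have ne: "exp u \<noteq> 1" using close[OF n] by (simp add: exp_minus)
    \<comment> \<open>Exchanging \<open>a\<close> and \<open>b\<close> replaces \<open>w\<close> by
      \<open>1 / w\<close>, so the estimate on the circle of radius \<open>exp N\<close> serves this
      side too.\<close>
    have "(a - b) * exp u / (1 - exp u) = - ((a - b) / (1 - exp (- u)))"
      using ne by (simp add: exp_minus divide_simps) (simp add: algebra_simps)
    then have "norm (Z (exp u) - a) = norm ((a - b) / (1 - exp (- u)))"
      using Za[OF ne] by simp
    then have z: "norm (Z (exp u) - a) < d2" using close[OF n] by (auto simp: d_def)
    have nz: "f (Z (exp u)) - b \<noteq> 0" using Zne[OF ne] fa inj by force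
    have "1 < norm (exp (G u))" unfolding expG[OF ne] using d2(2)[OF z] nz by (simp add: norm_divide)
    then show ?thesis using N0 by simp
  qed
  define A where "A = cball 0 (exp N) - ball (0::complex) (exp (- N))"
  have "compact A" unfolding A_def by (intro compact_diff) auto
  moreover have "continuous_on A \<kappa>"
    by (rule continuous_on_subset[OF cont\<kappa>]) (auto simp: A_def)
  ultimately have "bounded (\<kappa> ` A)" by (intro compact_imp_bounded compact_continuous_image)
  then obtain C where C: "\<And>w. w \<in> A \<Longrightarrow> norm (\<kappa> w) \<le> C" and C0: "C > 0"
    unfolding bounded_pos by auto
  have Im\<kappa>: "\<bar>Im (\<kappa> (exp u))\<bar> \<le> C" if "\<bar>Re u\<bar> \<le> N" for u
  proof -
    have "exp u \<in> A" using that by (auto simp: A_def)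
    then show ?thesis using C abs_Im_le_cmod order_trans by blast
  qed
  \<comment> \<open>\<open>C\<close> bounds the imaginary part of \<kappa> over the strip, and the
    deck translation by \<open>j\<close> adds at most 2 pi.\<close>
  define L where "L = C + 2 * pi"
  have ImG: "Im (G u) = Im (\<kappa> (exp u)) - Im u + of_int j * (2 * pi)" for u
    by (simp add: G_def)
  have jpi: "0 \<le> of_int j * (2 * pi)" "of_int j * (2 * pi) \<le> 2 * pi" by (auto simp: j_def)
  obtain u where u: "G u = u"
  proof (rule Poincare_Miranda_complex[OF contG N0 _ right left])
    show "L > 0" using C0 by (simp add: L_def add_pos_pos)
    show "Im (G u) < L" if "\<bar>Re u\<bar> \<le> N" "Im u = L" for u
      using Im\<kappa>[OF that(1)] that(2) jpi C0 pi_gt_zero unfolding ImG L_def by linarith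
    show "Im (G u) > - L" if "\<bar>Re u\<bar> \<le> N" "Im u = - L" for u
      using Im\<kappa>[OF that(1)] that(2) jpi C0 pi_gt_zero unfolding ImG L_def by linarith
  qed
  have ne: "exp u \<noteq> 1"
  proof
    assume 1: "exp u = 1"
    then obtain k :: int where k: "Re u = 0" "Im u = of_int (2 * k) * pi"
      by (auto simp: exp_eq_1)
    have "Im (G u) = of_int m * (2 * pi) - Im u + of_int j * (2 * pi)"
      using 1 by (simp add: G_def \<kappa>_def)
    then have "(of_int (m + j) * (2 * pi) :: real) = of_int (2 * k) * (2 * pi)"
      using u k(2) by (simp add: algebra_simps)
    then have "(of_int (m + j) :: real) = of_int (2 * k)" using pi_gt_zero by (simp only: mult_cancel_right) auto
    then have "m + j = 2 * k" by (simp only: of_int_eq_iff)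
    then show False unfolding j_def by (metis dvd_triv_left even_add odd_one add_0_right)
  qed
  let ?z = "Z (exp u)"
  have nz: "f ?z - b \<noteq> 0" "?z - b \<noteq> 0" using Zne[OF ne] fa inj by force+
  have "(f ?z - a) / (f ?z - b) = (?z - a) / (?z - b)"
    using expG[OF ne] Zratio[OF ne] u by simp
  then have "(f ?z - a) * (?z - b) = (?z - a) * (f ?z - b)"
    using nz by (simp add: frac_eq_eq)
  then have "(a - b) * (f ?z - ?z) = 0" by (simp add: algebra_simps)
  then show ?thesis using ab by auto
qed

section \<open>Brouwer homeomorphisms have only wandering points\<close>

text \<open>Brouwer homeomorphisms in the usual sense; orientation enters as
  \<open>positive_degree\<close>, which is inherited under the perturbations used below.\<close>

definition brouwer_homeo :: "(complex \<Rightarrow> complex) \<Rightarrow> bool" where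
  "brouwer_homeo f \<longleftrightarrow>
     (\<exists>g. homeomorphism UNIV UNIV f g) \<and> positive_degree f \<and> (\<forall>x. f x \<noteq> x)"

definition free_set :: "('a \<Rightarrow> 'a) \<Rightarrow> 'a set \<Rightarrow> bool" where
  "free_set f S \<longleftrightarrow> (\<forall>x\<in>S. f x \<notin> S)"

lemma brouwer_homeo_continuous: "brouwer_homeo f \<Longrightarrow> continuous_on UNIV f"
  by (auto simp: brouwer_homeo_def homeomorphism_def)

lemma brouwer_homeo_inj: "brouwer_homeo f \<Longrightarrow> inj f"
  by (metis brouwer_homeo_def homeomorphism_def inj_on_inverseI)

lemma brouwer_homeo_open_image:
  assumes "brouwer_homeo f" "open V"
  shows "open (f ` V)"
proof -
  obtain g where g: "homeomorphism UNIV UNIV f g" using assms(1) brouwer_homeo_def by blast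
  have "f ` V = g -` V"
    using g unfolding homeomorphism_def by (auto simp: image_iff) metis
  moreover have "continuous_on UNIV g" using g by (simp add: homeomorphism_def)
  ultimately show ?thesis using assms(2) by (simp add: open_vimage)
qed

text \<open>If \<open>\<psi> (f x) = x\<close> with \<open>f x \<in> S\<close>, then
  \<open>x \<in> S\<close> because \<psi> preserves \<open>S\<close>, against freeness; off
  \<open>S\<close> the map \<psi> is the identity and \<open>f\<close> has no fixed point. The
  bounded support of \<psi> gives it positive degree.\<close>

lemma brouwer_homeo_free_push:
  assumes f: "brouwer_homeo f" and S: "open S" "connected S" "free_set f S" and ab: "a \<in> S" "b \<in> S"
  shows "\<exists>\<psi>. brouwer_homeo (\<psi> \<circ> f) \<and> \<psi> a = b \<and>
    (\<forall>x. x \<notin> S \<longrightarrow> \<psi> x = x) \<and> (\<forall>x. x \<in> S \<longrightarrow> \<psi> x \<in> S)"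
proof -
  have aff: "affine hull S = UNIV" using S(1) ab(1) by (intro affine_hull_open) auto
  obtain \<psi> \<psi>' where \<psi>: "homeomorphism UNIV UNIV \<psi> \<psi>'" "\<psi> a = b"
    and supp: "{x. \<not> (\<psi> x = x \<and> \<psi>' x = x)} \<subseteq> S" and bdd: "bounded {x. \<not> (\<psi> x = x \<and> \<psi>' x = x)}"
    using homeomorphism_moving_point[of S UNIV a b] S ab aff by auto
  have out: "\<psi> x = x" if "x \<notin> S" for x using supp that by blast
  have inv: "\<psi>' (\<psi> x) = x" for x using \<psi>(1) by (simp add: homeomorphism_def)
  have inn: "\<psi> x \<in> S" if "x \<in> S" for x
  proof (rule ccontr)
    assume "\<psi> x \<notin> S"
    then have "\<psi>' (\<psi> x) = \<psi> x" using supp by blast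
    with inv \<open>\<psi> x \<notin> S\<close> that show False by metis
  qed
  have cont: "continuous_on UNIV \<psi>" using \<psi>(1) by (simp add: homeomorphism_def)
  have inj: "inj \<psi>" using inv by (rule inj_on_inverseI)
  have "positive_degree \<psi>"
    by (rule positive_degree_compact_support[OF cont inj]) (rule bounded_subset[OF bdd], auto)
  moreover have "positive_degree f" using f by (simp add: brouwer_homeo_def)
  ultimately have "positive_degree (\<psi> \<circ> f)"
    using brouwer_homeo_inj[OF f] brouwer_homeo_continuous[OF f] by (intro positive_degree_compose)
  moreover obtain g where "homeomorphism UNIV UNIV f g" using f brouwer_homeo_def by blast
  then have "homeomorphism UNIV UNIV (\<psi> \<circ> f) (g \<circ> \<psi>')"
    using \<psi>(1) by (rule homeomorphism_compose)
  moreover have "(\<psi> \<circ> f) x \<noteq> x" for x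
  proof
    assume eq: "(\<psi> \<circ> f) x = x"
    show False
    proof (cases "f x \<in> S")
      case True
      then have "x \<in> S" using inn[of "f x"] eq by simp
      with True S(3) show False by (simp add: free_set_def)
    next
      case False
      then show False using out[of "f x"] eq f by (simp add: brouwer_homeo_def)
    qed
  qed
  ultimately have "brouwer_homeo (\<psi> \<circ> f)" unfolding brouwer_homeo_def by blast
  then show ?thesis using \<psi>(2) out inn by blast
qed

lemma free_continuum_neighbourhood:
  fixes f :: "'a::euclidean_space \<Rightarrow> 'a"
  assumes cont: "continuous_on UNIV f" and K: "compact K" "connected K" "K \<noteq> {}" "free_set f K"
    and W: "open W" "K \<subseteq> W"
  obtains D where "open D" "connected D" "free_set f D" "K \<subseteq> D" "D \<subseteq> W"
proof -
  have "compact (f ` K)" using K(1) continuous_on_subset[OF cont] by (intro compact_continuous_image) auto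
  moreover have "K \<inter> f ` K = {}" using K(4) by (auto simp: free_set_def)
  ultimately obtain U V where UV: "open U" "open V" "K \<subseteq> U" "f ` K \<subseteq> V" "U \<inter> V = {}"
    using K(1) compact_imp_closed separation_normal by metis
  define D0 where "D0 = U \<inter> f -` V \<inter> W"
  have D0: "open D0" unfolding D0_def using UV W cont by (intro open_Int open_vimage) auto
  have KD0: "K \<subseteq> D0" using UV W by (auto simp: D0_def)
  obtain x where x: "x \<in> K" using K(3) by blast
  define D where "D = connected_component_set D0 x"
  have DD0: "D \<subseteq> D0" unfolding D_def by (rule connected_component_subset)
  show ?thesis
  proof
    show "open D" unfolding D_def using D0 by (rule open_connected_component)
    show "connected D" unfolding D_def by simp
    show "free_set f D" using DD0 UV(5) by (auto simp: free_set_def D0_def)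
    show "K \<subseteq> D" unfolding D_def using x K(2) KD0 by (rule connected_component_maximal)
    show "D \<subseteq> W" using DD0 by (auto simp: D0_def)
  qed
qed

lemma free_ball_exists:
  fixes f :: "'a::metric_space \<Rightarrow> 'a"
  assumes "continuous_on UNIV f" and "f y \<noteq> y"
  obtains e where "e > 0" "\<And>d. d \<le> e \<Longrightarrow> free_set f (ball y d)"
proof -
  obtain U V where UV: "open U" "open V" "y \<in> U" "f y \<in> V" "U \<inter> V = {}"
    using assms(2) hausdorff by metis
  have "open (U \<inter> f -` V)" using UV assms(1) by (intro open_Int open_vimage) auto
  then obtain e where e: "e > 0" "ball y e \<subseteq> U \<inter> f -` V" using UV openE by (metis IntI vimageI2)
  have "free_set f (ball y d)" if "d \<le> e" for d
    using e(2) subset_ball[OF that, of y] UV(5) unfolding free_set_def by blast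
  with e(1) show ?thesis by (rule that)
qed

lemma critical_ball_exists:
  assumes f: "brouwer_homeo f"
  obtains r z where "r > 0" "free_set f (ball p r)" "z \<in> sphere p r" "f z \<in> sphere p r"
proof -
  have cont: "continuous_on UNIV f" using f by (rule brouwer_homeo_continuous)
  \<comment> \<open>\<open>\<phi> x\<close> is the infimum of the radii of balls around
    \<open>p\<close> containing both \<open>x\<close> and \<open>f x\<close>, so the minimum of
    \<phi> is the largest radius of a free open ball around \<open>p\<close>.\<close>
  define \<phi> where "\<phi> x = max (dist p x) (dist p (f x))" for x
  have "continuous_on (cball p (\<phi> p)) \<phi>"
    unfolding \<phi>_def by (intro continuous_intros continuous_on_subset[OF cont]) auto
  then obtain z where z: "z \<in> cball p (\<phi> p)" "\<And>x. x \<in> cball p (\<phi> p) \<Longrightarrow> \<phi> z \<le> \<phi> x"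
    using continuous_attains_inf[of "cball p (\<phi> p)" \<phi>] by (auto simp: \<phi>_def)
  have min: "\<phi> z \<le> \<phi> x" for x
  proof (cases "x \<in> cball p (\<phi> p)")
    case False
    have "\<phi> z \<le> \<phi> p" by (rule z) (simp add: \<phi>_def)
    also have "\<dots> \<le> dist p x" using False by simp
    also have "\<dots> \<le> \<phi> x" by (simp add: \<phi>_def)
    finally show ?thesis .
  qed (rule z)
  define r where "r = \<phi> z"
  have free: "free_set f (ball p r)"
    unfolding free_set_def
  proof (intro ballI notI)
    fix x assume "x \<in> ball p r" "f x \<in> ball p r"
    then have "\<phi> x < r" by (simp add: \<phi>_def)
    with min[of x] show False by (simp add: r_def)
  qed
  have r0: "r > 0"
  proof (rule ccontr)
    assume "\<not> r > 0"
    then have "dist p z \<le> 0" "dist p (f z) \<le> 0" by (auto simp: r_def \<phi>_def not_less)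
    then have "f z = z" by simp
    then show False using f by (simp add: brouwer_homeo_def)
  qed
  have cl: "\<exists>w\<in>V. w \<in> ball p r" if "open V" "x \<in> V" "x \<in> cball p r" for V x
    using that r0 open_Int_closure_eq_empty[of V "ball p r"] closure_ball[of r p] by auto
  have zc: "z \<in> cball p r" "f z \<in> cball p r" by (auto simp: r_def \<phi>_def)
  \<comment> \<open>If \<open>z\<close> were inside, the open image of the ball would be a
    neighbourhood of \<open>f z\<close>, a point of the closed ball, and would meet the ball. The
    other case uses the open preimage.\<close>
  have "z \<notin> ball p r"
  proof
    assume "z \<in> ball p r"
    then have "f z \<in> f ` ball p r" by (rule imageI)
    from cl[OF brouwer_homeo_open_image[OF f open_ball] this zc(2)] free
    show False unfolding free_set_def by blast
  qed
  moreover have "f z \<notin> ball p r"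
  proof
    assume "f z \<in> ball p r"
    then have "z \<in> f -` ball p r" by (rule vimageI2)
    from cl[OF open_vimage[OF open_ball cont] this zc(1)] free
    show False unfolding free_set_def by blast
  qed
  ultimately show ?thesis using that[OF r0 free] zc by (auto simp: less_eq_real_def)
qed

text \<open>The induction step in shortening the return time of a free set: a periodic orbit of period
  \<open>n \<ge> 3\<close> gives, for a perturbed map, a free ball returning after \<open>n - 1\<close> steps. In the critical ball
  around \<open>p\<close>, with \<open>z\<close> and \<open>f z\<close> on its boundary, the radius \<open>[p, f z]\<close> followed by the image of
  the radius from \<open>z\<close> to a point close to \<open>p\<close> is a free arc from \<open>p\<close> almost to \<open>f p\<close>; pushing \<open>p\<close> along
  it skips one step of the orbit.\<close>

lemma periodic_point_shortening:
  fixes p :: complex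
  assumes f: "brouwer_homeo f" and n: "n \<ge> 3" and per: "(f ^^ n) p = p"
    and IH: "\<And>h m S u. brouwer_homeo h \<Longrightarrow> 1 \<le> m \<Longrightarrow> m < n \<Longrightarrow> open S \<Longrightarrow> connected S \<Longrightarrow>
      free_set h S \<Longrightarrow> u \<in> S \<Longrightarrow> (h ^^ m) u \<notin> S"
  shows False
proof -
  have cont: "continuous_on UNIV f" using f by (rule brouwer_homeo_continuous)
  have inj: "f x = f y \<longleftrightarrow> x = y" for x y using brouwer_homeo_inj[OF f] by (simp add: inj_eq)
  have nofix: "f x \<noteq> x" for x using f by (simp add: brouwer_homeo_def)
  obtain r z where r: "r > 0" and free: "free_set f (ball p r)"
    and zs: "z \<in> sphere p r" "f z \<in> sphere p r"
    using critical_ball_exists[OF f] by blast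
  define B where "B = ball p r"
  have pB: "p \<in> B" using r by (simp add: B_def)
  have A1: "f x \<notin> B" if "x \<in> B" for x using free that by (simp add: free_set_def B_def)
  \<comment> \<open>This is where \<open>n \<ge> 3\<close> enters: a return time of 2 is excluded by
    \<open>IH\<close>.\<close>
  have A2: "f (f x) \<notin> B" if "x \<in> B" for x
    using IH[OF f, of 2 B x] that n free by (simp add: B_def numeral_2_eq_2)
  have cl: "\<exists>w\<in>V. w \<in> B" if "open V" "x \<in> V" "x \<in> sphere p r" for V x
    using that r open_Int_closure_eq_empty[of V B] closure_ball[of r p] by (auto simp: B_def)
  have oB: "open B" by (simp add: B_def)
  have zB: "z \<notin> B" "f z \<notin> B" using zs by (auto simp: B_def)
  have zfB: "z \<noteq> f x" if "x \<in> B" for x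
    using cl[OF brouwer_homeo_open_image[OF f oB], of z] zs A1 that by auto
  have ffz: "f (f z) \<notin> B"
    using cl[OF open_vimage[OF open_vimage[OF oB cont] cont], of z] zs A2 by auto
  have seg: "closed_segment p y \<subseteq> insert y B" if "y \<in> sphere p r" for y
  proof
    fix w assume "w \<in> closed_segment p y"
    then obtain t where t: "0 \<le> t" "t \<le> 1" "w = (1 - t) *\<^sub>R p + t *\<^sub>R y"
      by (auto simp: closed_segment_def)
    have "w - p = t *\<^sub>R (y - p)" by (simp add: t algebra_simps)
    then have "dist w p = t * r" using that t(1) by (simp add: dist_norm norm_minus_commute)
    then show "w \<in> insert y B" using t r by (cases "t = 1") (auto simp: B_def dist_commute t(3))
  qed
  have segz: "closed_segment z p \<subseteq> insert z B" using seg[OF zs(1)] by (simp add: closed_segment_commute)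
  note segfz = seg[OF zs(2)]

  \<comment> \<open>The complete arc from \<open>p\<close> to \<open>f p\<close>. The ball
    \<open>E\<close> is chosen off this arc first, because the truncation parameter \<open>s\<close>
    depends on \<open>E\<close>.\<close>
  define \<beta>0 where "\<beta>0 = closed_segment p (f z) \<union> f ` closed_segment z p"
  have "compact \<beta>0"
    unfolding \<beta>0_def using continuous_on_subset[OF cont] by (intro compact_Un compact_continuous_image) auto
  have c: "f (f p) \<notin> \<beta>0"
    using A1[OF pB] A2[OF pB] zfB[OF pB] segz segfz inj by (auto simp: \<beta>0_def)
  have "open (- \<beta>0)" using \<open>compact \<beta>0\<close> by (simp add: compact_imp_closed open_Compl)
  with c obtain e1 where e1: "e1 > 0" "ball (f (f p)) e1 \<subseteq> - \<beta>0" using openE by blast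
  obtain e2 where e2: "e2 > 0" "\<And>d. d \<le> e2 \<Longrightarrow> free_set f (ball (f (f p)) d)"
    using free_ball_exists[OF cont nofix] by blast
  \<comment> \<open>Halving \<open>e1\<close> keeps the closed ball of radius \<open>e\<close> off
    the arc; \<open>W\<close> is the complement of that closed ball.\<close>
  define e where "e = min (e1 / 2) e2"
  have e: "e > 0" "e < e1" "e \<le> e2" using e1 e2 by (auto simp: e_def)
  define E where "E = ball (f (f p)) e"
  define W where "W = - cball (f (f p)) e"
  have Efree: "free_set f E" using e2 e by (simp add: E_def)
  have WE: "x \<notin> E" if "x \<in> W" for x using that by (auto simp: W_def E_def)
  have "\<beta>0 \<subseteq> W"
  proof
    fix x assume "x \<in> \<beta>0"
    then have "x \<notin> ball (f (f p)) e1" using e1 by blast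
    then show "x \<in> W" using e by (simp add: W_def)
  qed

  have "open ((f \<circ> f) -` E)"
    using cont by (intro open_vimage continuous_on_compose) (auto intro: continuous_on_subset simp: E_def)
  moreover have "p \<in> (f \<circ> f) -` E" using e by (simp add: E_def)
  ultimately obtain \<eta> where \<eta>: "\<eta> > 0" "ball p \<eta> \<subseteq> (f \<circ> f) -` E" using openE by blast
  \<comment> \<open>The complete arc contains \<open>p\<close> and \<open>f p\<close> and is not
    free, so it stops at \<open>f p'\<close> with \<open>p' \<noteq> p\<close>. The bound on
    \<open>s\<close> places \<open>p'\<close> so close to \<open>p\<close> that
    \<open>f (f p')\<close> lies in \<open>E\<close>.\<close>
  define s where "s = min 1 (\<eta> / (2 * r))"
  have s: "0 < s" "s \<le> 1" "s * r < \<eta>"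
  proof -
    show "0 < s" "s \<le> 1" using \<eta> r by (auto simp: s_def)
    have "s * r \<le> \<eta> / (2 * r) * r" using r by (intro mult_right_mono) (auto simp: s_def)
    then show "s * r < \<eta>" using r \<eta> by simp
  qed
  define p' where "p' = p + s *\<^sub>R (z - p)"
  have np: "norm (z - p) = r" "norm (f z - p) = r" using zs by (auto simp: dist_norm norm_minus_commute)
  have "dist p p' = s * r" using s by (simp add: p'_def dist_norm np)
  then have "p' \<in> ball p \<eta>" using s by simp
  then have ffp': "f (f p') \<in> E" using \<eta>(2) by auto
  have param: "\<exists>t>0. t \<le> 1 \<and> w = p + t *\<^sub>R (z - p)" if w: "w \<in> closed_segment z p'" for w
  proof -
    obtain t where t: "0 \<le> t" "t \<le> 1" "w = (1 - t) *\<^sub>R z + t *\<^sub>R p'"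
      using w by (auto simp: closed_segment_def)
    have "w = p + ((1 - t) + t * s) *\<^sub>R (z - p)" by (simp add: t p'_def algebra_simps)
    moreover have "(1 - t) + t * s > 0"
      using t s by (cases "t = 1") (auto intro: add_pos_nonneg)
    moreover have "(1 - t) + t * s \<le> 1" using t s by (simp add: mult_left_le)
    ultimately show ?thesis by blast
  qed
  have segz': "closed_segment z p' \<subseteq> closed_segment z p"
  proof
    fix w assume "w \<in> closed_segment z p'"
    then obtain t where t: "0 < t" "t \<le> 1" "w = p + t *\<^sub>R (z - p)" using param by blast
    then have "w = (1 - t) *\<^sub>R p + t *\<^sub>R z" by (simp add: algebra_simps)
    then have "w \<in> closed_segment p z" using t by (auto simp: closed_segment_def)
    then show "w \<in> closed_segment z p" by (simp add: closed_segment_commute)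
  qed
  then have segz'B: "closed_segment z p' \<subseteq> insert z B" using segz by blast
  \<comment> \<open>The two radii have the same length, so a common point other than
    \<open>p\<close> has the same parameter on both and forces \<open>z = f z\<close>.\<close>
  have disj: "w \<notin> closed_segment p (f z)" if w': "w \<in> closed_segment z p'" for w
  proof
    assume "w \<in> closed_segment p (f z)"
    then obtain t' where t': "0 \<le> t'" "w = (1 - t') *\<^sub>R p + t' *\<^sub>R f z"
      by (auto simp: closed_segment_def)
    obtain t where t: "0 < t" "w = p + t *\<^sub>R (z - p)" using param[OF w'] by blast
    have w: "w - p = t *\<^sub>R (z - p)" "w - p = t' *\<^sub>R (f z - p)"
      by (simp add: t) (simp add: t' algebra_simps)
    have "norm (w - p) = t * r" unfolding w(1) using t(1) np by simp
    moreover have "norm (w - p) = t' * r" unfolding w(2) using t'(1) np by simp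
    ultimately have "t = t'" using r by simp
    then have "z = f z" using w t by simp
    then show False using nofix by metis
  qed

  define \<beta> where "\<beta> = closed_segment p (f z) \<union> f ` closed_segment z p'"
  have "compact \<beta>"
    unfolding \<beta>_def using continuous_on_subset[OF cont] by (intro compact_Un compact_continuous_image) auto
  moreover have "connected \<beta>"
    unfolding \<beta>_def
  proof (rule connected_Un)
    show "connected (f ` closed_segment z p')"
      by (intro connected_continuous_image continuous_on_subset[OF cont]) auto
  qed auto
  moreover have "\<beta> \<noteq> {}" by (simp add: \<beta>_def)
  moreover have "free_set f \<beta>"
    unfolding free_set_def
  proof (intro ballI notI)
    fix x assume x: "x \<in> \<beta>" "f x \<in> \<beta>"
    show False
    proof (cases "x \<in> closed_segment p (f z)")
      case True
      then have "f x \<notin> f ` closed_segment z p'" using disj inj by auto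
      then have "f x \<in> insert (f z) B" using x(2) segfz by (auto simp: \<beta>_def)
      moreover have "x \<in> B \<or> x = f z" using True segfz by auto
      ultimately show False using A1 zB ffz nofix[of z] nofix[of "f z"] nofix[symmetric, of z] inj by auto
    next
      case False
      then obtain y where y: "y \<in> closed_segment z p'" "x = f y" using x(1) by (auto simp: \<beta>_def)
      have yB: "y = z \<or> y \<in> B" using y(1) segz'B by blast
      have "f (f y) \<notin> insert (f z) B"
        using yB ffz nofix[of "f z"] A2 zfB inj by auto
      then have "f (f y) \<in> f ` closed_segment z p'" using x(2) y(2) segfz by (auto simp: \<beta>_def)
      then have "f y \<in> insert z B" using inj segz'B by auto
      then show False using yB zB nofix[of z] A1 zfB by fastforce
    qed
  qed
  moreover have "open W" by (simp add: W_def open_Compl)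
  moreover have "\<beta> \<subseteq> W" using \<open>\<beta>0 \<subseteq> W\<close> segz' by (auto simp: \<beta>_def \<beta>0_def)
  ultimately obtain D where D: "open D" "connected D" "free_set f D" "\<beta> \<subseteq> D" "D \<subseteq> W"
    using free_continuum_neighbourhood[OF cont] by metis
  have pD: "p \<in> D" "f p' \<in> D" using D(4) by (auto simp: \<beta>_def)
  obtain \<psi> where \<psi>: "brouwer_homeo (\<psi> \<circ> f)" "\<psi> p = f p'"
    and out: "\<And>x. x \<notin> D \<Longrightarrow> \<psi> x = x" and inn: "\<And>x. x \<in> D \<Longrightarrow> \<psi> x \<in> D"
    using brouwer_homeo_free_push[OF f D(1-3) pD] by (elim exE conjE) simp
  define h where "h = \<psi> \<circ> f"
  have orbit: "(f ^^ j) p \<notin> D" if "1 \<le> j" "j < n" for j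
    using IH[OF f that D(1-3) pD(1)] .
  \<comment> \<open>The points \<open>(f ^^ j) p\<close> with \<open>1 \<le> j < n\<close> avoid
    \<open>D\<close>, so \<psi> fixes them; the last index reached is
    \<open>i + 2 = n - 1\<close>.\<close>
  have shifted: "(h ^^ i) (f (f p)) = (f ^^ (i + 2)) p" if "i + 3 \<le> n" for i
    using that
  proof (induction i)
    case (Suc i)
    then have "(h ^^ Suc i) (f (f p)) = h ((f ^^ (i + 2)) p)" by simp
    also have "\<dots> = \<psi> ((f ^^ (Suc i + 2)) p)" by (simp add: h_def)
    also have "\<dots> = (f ^^ (Suc i + 2)) p" using Suc.prems by (intro out orbit) auto
    finally show ?case .
  qed simp
  \<comment> \<open>Step \<open>Suc k\<close> would arrive at \<open>(f ^^ n) p = p\<close> and is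
    diverted to \<open>f p'\<close>. The next step lands in \<open>E\<close>, so \<open>E\<close>
    returns after \<open>n - 1\<close> steps.\<close>
  obtain k where k: "n = k + 3" using n by (metis add.commute le_Suc_ex)
  have "(h ^^ Suc k) (f (f p)) = h ((f ^^ (k + 2)) p)" using shifted[of k] by (simp add: k)
  also have "\<dots> = \<psi> ((f ^^ n) p)" by (simp add: k h_def numeral_3_eq_3)
  finally have "(h ^^ Suc k) (f (f p)) = f p'" using per \<psi> by simp
  then have "(h ^^ Suc (Suc k)) (f (f p)) = h (f p')" by simp
  also have "\<dots> = \<psi> (f (f p'))" by (simp add: h_def)
  also have "\<dots> = f (f p')" using D(3) pD(2) by (intro out) (simp add: free_set_def)
  finally have "(h ^^ Suc (Suc k)) (f (f p)) \<in> E" using ffp' by simp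
  moreover have "free_set h E"
    unfolding free_set_def h_def
  proof (intro ballI)
    fix x assume "x \<in> E"
    show "(\<psi> \<circ> f) x \<notin> E"
    proof (cases "f x \<in> D")
      case True
      then show ?thesis using inn[OF True] D(5) WE by auto
    next
      case False
      then show ?thesis using out[OF False] Efree \<open>x \<in> E\<close> by (simp add: free_set_def)
    qed
  qed
  moreover have "f (f p) \<in> E" using e by (simp add: E_def)
  moreover have "brouwer_homeo h" using \<psi> by (simp add: h_def)
  ultimately show False
    using IH[of h "Suc (Suc k)" E "f (f p)"] by (simp add: k E_def)
qed

text \<open>For a return after \<open>n\<close> steps, shorter returns are excluded by induction, so
  pushing \<open>(f ^^ n) u\<close> to \<open>u\<close> inside \<open>S\<close> alters only the last
  step and creates a periodic orbit. Both \<open>f\<close> and \<open>S\<close> vary in the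
  induction, since shortening replaces them.\<close>

lemma free_set_no_return:
  assumes "brouwer_homeo f" "n \<ge> 1" "open S" "connected S" "free_set f S" "u \<in> S"
  shows "(f ^^ n) u \<notin> S"
  using assms
proof (induction n arbitrary: f S u rule: less_induct)
  case (less n)
  show ?case
  proof
    assume ret: "(f ^^ n) u \<in> S"
    have "n \<noteq> 1" using less.prems(5,6) ret by (auto simp: free_set_def)
    obtain \<psi> where \<psi>: "brouwer_homeo (\<psi> \<circ> f)" "\<psi> ((f ^^ n) u) = u"
      and out: "\<And>x. x \<notin> S \<Longrightarrow> \<psi> x = x"
      using brouwer_homeo_free_push[OF less.prems(1,3,4,5) ret less.prems(6)] by (elim exE conjE) simp
    define h where "h = \<psi> \<circ> f"
    have same: "(h ^^ i) u = (f ^^ i) u" if "i < n" for i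
      using that
    proof (induction i)
      case (Suc i)
      then have "(h ^^ Suc i) u = h ((f ^^ i) u)" by simp
      also have "\<dots> = \<psi> ((f ^^ Suc i) u)" by (simp add: h_def)
      also have "\<dots> = (f ^^ Suc i) u"
        using less.IH[OF Suc.prems less.prems(1) _ less.prems(3-6)] by (intro out) simp
      finally show ?case .
    qed simp
    obtain k where k: "n = Suc k" using less.prems(2) by (cases n) auto
    have "(h ^^ n) u = h ((f ^^ k) u)" using same[of k] by (simp add: k)
    also have "\<dots> = u" using \<psi>(2) by (simp add: k h_def)
    finally have per: "(h ^^ n) u = u" .
    have h: "brouwer_homeo h" using \<psi>(1) by (simp add: h_def)
    show False
    proof (cases "n = 2")
      \<comment> \<open>\<open>h\<close> exchanges \<open>u\<close> and \<open>h u\<close>, which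
        differ because \<open>h\<close> has no fixed point.\<close>
      case True
      obtain g where "homeomorphism UNIV UNIV h g" "positive_degree h" "\<And>x. h x \<noteq> x"
        using h by (auto simp: brouwer_homeo_def)
      then show False
        using exchanged_points_imp_fixed_point[of h g u "h u"] per True by (metis funpow_0 funpow_simps_right(2) comp_apply numeral_2_eq_2)
    next
      case False
      then have "n \<ge> 3" using less.prems(2) \<open>n \<noteq> 1\<close> by linarith
      then show False
        using periodic_point_shortening[OF h _ per] less.IH by blast
    qed
  qed
qed

lemma brouwer_homeo_wandering:
  assumes f: "brouwer_homeo f"
  obtains U where "open U" "y \<in> U" "\<And>n u. n \<ge> 1 \<Longrightarrow> u \<in> U \<Longrightarrow> (f ^^ n) u \<notin> U"
proof -
  have "f y \<noteq> y" using f by (simp add: brouwer_homeo_def)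
  then obtain e where "e > 0" "free_set f (ball y e)"
    using free_ball_exists[OF brouwer_homeo_continuous[OF f]] by blast
  then show ?thesis
    by (intro that[of "ball y e"] free_set_no_return[OF f]) auto
qed

section \<open>Conjugation to \<open>complex\<close> and transport of wandering neighbourhoods back
  to \<open>real^2\<close>\<close>

theorem theorem1:
  fixes f g :: "real^2 \<Rightarrow> real^2"
  assumes "homeomorphism UNIV UNIV f g"
    and "orientation_preserving f"
    and "topological_shadowing f"
  shows "\<exists>x. f x = x"
proof (rule ccontr)
  assume nofix: "\<nexists>x. f x = x"
  define F where "F = complex_of_vec \<circ> f \<circ> vec_of_complex"
  have cont: "continuous_on UNIV f" "continuous_on UNIV g" and gf: "\<And>x. g (f x) = x" and fg: "\<And>x. f (g x) = x"
    using assms(1) by (auto simp: homeomorphism_def)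
  have inj: "inj f" using gf by (rule inj_on_inverseI)
  have "homeomorphism UNIV UNIV F (complex_of_vec \<circ> g \<circ> vec_of_complex)"
  proof (rule homeomorphismI)
    show "continuous_on UNIV F" "continuous_on UNIV (complex_of_vec \<circ> g \<circ> vec_of_complex)"
      unfolding F_def o_def
      by (intro continuous_intros continuous_on_compose2[OF cont(1)] continuous_on_compose2[OF cont(2)]; simp)+
  qed (auto simp: F_def gf fg)
  moreover have "positive_degree F"
    unfolding F_def using assms(2) cont(1) inj by (rule orientation_preserving_imp_positive_degree)
  moreover have "F z \<noteq> z" for z
    using nofix by (metis F_def comp_apply vec_of_complex_inverse)
  ultimately have F: "brouwer_homeo F" by (auto simp: brouwer_homeo_def)
  have step: "complex_of_vec (f v) = F (complex_of_vec v)" for v by (simp add: F_def)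
  have iter: "complex_of_vec ((f ^^ n) v) = (F ^^ n) (complex_of_vec v)" for n v
    by (induction n) (simp_all add: step)
  have "\<exists>U. open U \<and> y \<in> U \<and> (\<forall>n\<ge>1. \<forall>u\<in>U. (f ^^ n) u \<notin> U)" for y
  proof -
    obtain U where U: "open U" "complex_of_vec y \<in> U" "\<And>n u. n \<ge> 1 \<Longrightarrow> u \<in> U \<Longrightarrow> (F ^^ n) u \<notin> U"
      using brouwer_homeo_wandering[OF F] by metis
    have "open (complex_of_vec -` U)"
      using U(1) continuous_on_complex_of_vec[OF continuous_on_id] by (rule open_vimage)
    then show ?thesis using U(2,3) by (intro exI[of _ "complex_of_vec -` U"]) (auto simp: iter)
  qed
  then show False
    using wandering_imp_not_topological_shadowing[OF assms(1)] assms(3) by blast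
qed

end
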